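(* Let $\beta>0$ be a real number and let $p$ be analytic in $\mathbb{D}$ with $p(0)=1$. If $$p^2(z)+\beta zp'(z)\prec 1+z,$$ then $p(z)\prec\sqrt{1+z}$.
   Context: $\mathbb{D}=\{z\in\mathbb{C}:|z|<1\}$; $p^k(z)=(p(z))^k$. For analytic $f,g$ on $\mathbb{D}$, $f\prec g$ ($f$ is subordinate to $g$) means there is an analytic $w:\mathbb{D}\to\mathbb{D}$ with $w(0)=0$ and $f(z)=g(w(z))$ for all $z\in\mathbb{D}$. $\sqrt{1+z}$ is the principal branch; it maps $\mathbb{D}$ univalently onto $\{w:|w^2-1|<1,\ \operatorname{Re}w>0\}$. *)

theory Defs
  imports "HOL-Analysis.Analysis"
begin

abbreviation unit_disc :: "complex set" where
  "unit_disc \<equiv> ball 0 1"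

text \<open>Subordination is a relation between functions analytic on the unit disc, so analyticity
  of both sides is part of the definition; the values outside the disc are irrelevant.\<close>

definition subordinate :: "(complex \<Rightarrow> complex) \<Rightarrow> (complex \<Rightarrow> complex) \<Rightarrow> bool"
    (infix "\<prec>" 50) where
  "f \<prec> g \<longleftrightarrow> f analytic_on unit_disc \<and> g analytic_on unit_disc \<and>
     (\<exists>w. w analytic_on unit_disc \<and> w ` unit_disc \<subseteq> unit_disc \<and> w 0 = 0 \<and>
          (\<forall>z\<in>unit_disc. f z = g (w z)))"

end

theory Submission
  imports Defs "HOL-Complex_Analysis.Complex_Analysis"
begin

text \<open>Put \<open>w = p\<^sup>2 - 1\<close>. If \<open>\<bar>w\<bar> < 1\<close> on the disc then \<open>p\<^sup>2 = 1 + w\<close> has positive real part,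
  hence so has \<open>p\<close> (by connectedness), and \<open>p = csqrt (1 + w)\<close>. If not, take a point \<open>z\<^sub>0\<close> of
  least modulus with \<open>\<bar>w z\<^sub>0\<bar> = 1\<close>. Jack's lemma gives \<open>z\<^sub>0 w'(z\<^sub>0) = m w(z\<^sub>0)\<close> with \<open>m \<ge> 1\<close>; as
  \<open>w' = 2 p p'\<close> this forces \<open>p z\<^sub>0 \<noteq> 0\<close>, which keeps \<open>z\<^sub>0\<close> away from the corner of the lemniscate,
  and \<open>p\<^sup>2 + \<beta> z p' - 1 = w (1 + \<beta> m / (2 p))\<close> at \<open>z\<^sub>0\<close>. Since \<open>Re (p z\<^sub>0) \<ge> 0\<close>, its modulus
  is at least 1, contradicting the subordination to \<open>1 + z\<close>.\<close>

text \<open>After normalising so that \<open>z0\<close> and \<open>w z0\<close> both become 1, the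
  quotient \<open>z0 * deriv w z0 / w z0\<close> is the derivative at 1 of a map obeying the Schwarz
  lemma. Its behaviour along the unit circle makes this derivative real, and its behaviour along the
  radius makes it at least 1.\<close>

lemma Jack_lemma:
  fixes w :: "complex \<Rightarrow> complex"
  assumes hol: "w holomorphic_on S" and S: "open S" "cball 0 (norm z0) \<subseteq> S"
    and w0: "w 0 = 0" and z0: "z0 \<noteq> 0"
    and less: "\<And>z. norm z < norm z0 \<Longrightarrow> norm (w z) < norm (w z0)"
  obtains m :: real where "m \<ge> 1" "z0 * deriv w z0 = of_real m * w z0"
proof -
  have W: "w z0 \<noteq> 0"
    using less[of 0] z0 w0 by auto
  define F where "F = (\<lambda>z. w (z0 * z) / w z0)"
  have scaled: "norm (z0 * z) < norm z0" if "norm z < 1" for z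
    using that z0 by (simp add: norm_mult)
  have schwarz: "norm (F z) \<le> norm z" if "norm z < 1" for z
  proof (rule Schwarz_Lemma(1)[of F z])
    have "(\<lambda>z. w (z0 * z)) holomorphic_on ball 0 1"
      by (rule holomorphic_on_compose_gen[OF _ hol, unfolded o_def])
         (use S(2) scaled in \<open>force intro!: holomorphic_intros simp: subset_iff intro: less_imp_le\<close>)+
    then show "F holomorphic_on ball 0 1"
      unfolding F_def using W by (intro holomorphic_intros)
    show "norm (F z) < 1" if "norm z < 1" for z
      using less[OF scaled[OF that]] W by (simp add: F_def norm_divide)
  qed (use w0 that in \<open>auto simp: F_def\<close>)
  have le: "norm (w z) \<le> norm (w z0)" if "norm z \<le> norm z0" for z
  proof (rule continuous_on_closure_norm_le[of "ball 0 (norm z0)" w])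
    show "continuous_on (closure (ball 0 (norm z0))) w"
      using holomorphic_on_imp_continuous_on[OF hol] S(2) z0
      by (auto intro: continuous_on_subset)
  qed (use less that z0 in \<open>auto intro: less_imp_le\<close>)
  have circle: "norm (F z) \<le> 1" if "norm z = 1" for z
    using le[of "z0 * z"] that W by (simp add: F_def norm_mult norm_divide)
  define D where "D = z0 * deriv w z0 / w z0"
  have "z0 \<in> S"
    using S(2) by auto
  then have "(w has_field_derivative deriv w z0) (at (z0 * exp 0))"
    using hol S(1) holomorphic_derivI by fastforce
  then have "((\<lambda>s. w (z0 * exp s)) has_field_derivative (deriv w z0 * z0)) (at 0)"
    by (rule DERIV_chain2) (auto intro!: derivative_eq_intros)
  from DERIV_cdivide[OF this, of "w z0"]
  have der: "((\<lambda>s. F (exp s)) has_field_derivative D) (at 0)"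
    by (simp add: F_def D_def mult.commute)
  \<comment> \<open>The curve \<open>exp (c * t)\<close> passes through 1 at \<open>t = 0\<close>.
    It traces the unit circle for \<open>c = \<i>\<close> and the positive real axis for
    \<open>c = 1\<close>, so one formula covers both directions.\<close>
  have der_line: "((\<lambda>t::real. Re (F (exp (c * of_real t)))) has_real_derivative Re (c * D)) (at 0)" for c
  proof -
    have "((\<lambda>s. F (exp s)) has_field_derivative D) (at (c * of_real 0))"
      using der by simp
    then have "((\<lambda>s. F (exp (c * s))) has_field_derivative (D * c)) (at (of_real 0))"
      by (rule DERIV_chain2) (rule DERIV_cmult_Id)
    from has_vector_derivative_real_field[OF this] show ?thesis
      by (intro has_field_derivative_Re) (simp add: mult.commute)
  qed
  have F1: "F (exp (c * of_real 0)) = 1" for c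
    using W by (simp add: F_def)
  \<comment> \<open>On the circle \<open>Re F\<close> is at most 1, its value at 1, so its
    tangential derivative, which is minus the imaginary part of \<open>D\<close>, vanishes.\<close>
  have "Re (\<i> * D) = 0"
  proof (rule DERIV_local_max[OF der_line[of \<i>], of 1])
    have "Re (F (exp (\<i> * of_real y))) \<le> 1" for y
      using circle[of "exp (\<i> * of_real y)"] complex_Re_le_cmod[of "F (exp (\<i> * of_real y))"]
      by simp
    then show "\<forall>y. \<bar>0 - y\<bar> < 1 \<longrightarrow> Re (F (exp (\<i> * of_real y))) \<le> Re (F (exp (\<i> * of_real 0)))"
      unfolding F1 by simp
  qed simp
  then have D: "D = of_real (Re D)"
    by (simp add: complex_eq_iff)
  have "Re D \<ge> 1"
  proof (rule ccontr)
    assume "\<not> Re D \<ge> 1"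
    then have neg: "Re (1 * D) - 1 < 0"
      by simp
    \<comment> \<open>This difference is 0 at \<open>t = 0\<close>; a negative slope would make it
      positive just to the left, where \<open>schwarz\<close> makes it at most 0.\<close>
    have "((\<lambda>t::real. Re (F (exp (1 * of_real t))) - exp t) has_real_derivative Re (1 * D) - 1) (at 0)"
      using DERIV_diff[OF der_line[of 1] DERIV_exp[of "0::real"]] by simp
    from DERIV_neg_dec_left[OF this neg] obtain d where d: "d > 0" "\<And>h. h > 0 \<Longrightarrow> h < d \<Longrightarrow>
        Re (F (exp (1 * of_real 0))) - exp 0 < Re (F (exp (1 * of_real (0 - h)))) - exp (0 - h)"
      by blast
    have "norm (F (exp (of_real (-(d/2))))) \<le> norm (exp (complex_of_real (-(d/2))))"
      using d(1) by (intro schwarz) auto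
    then have "Re (F (exp (of_real (-(d/2))))) \<le> exp (-(d/2))"
      using complex_Re_le_cmod[of "F (exp (of_real (-(d/2))))"] by simp
    with d(2)[of "d/2"] d(1) F1[of 1] show False
      by simp
  qed
  moreover have "z0 * deriv w z0 = of_real (Re D) * w z0"
    using W D by (simp add: D_def field_simps)
  ultimately show thesis
    using that by blast
qed

text \<open>A point where \<open>Re p\<close> vanishes would give \<open>p^2\<close> a nonpositive
  real part, so on a connected set \<open>Re p\<close> cannot change sign.\<close>

lemma Re_pos_if_Re_power2_pos:
  fixes p :: "complex \<Rightarrow> complex"
  assumes "connected S" "continuous_on S p" "a \<in> S" "Re (p a) > 0"
    and sq: "\<And>z. z \<in> S \<Longrightarrow> Re ((p z)^2) > 0"
    and "z \<in> S"
  shows "Re (p z) > 0"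
proof (rule ccontr)
  assume "\<not> Re (p z) > 0"
  moreover have "connected ((\<lambda>z. Re (p z)) ` S)"
    using assms by (intro connected_continuous_image continuous_intros)
  ultimately have "0 \<in> (\<lambda>z. Re (p z)) ` S"
    using assms connectedD_interval[of _ "Re (p z)" "Re (p a)" 0] by force
  then obtain y where "y \<in> S" "Re (p y) = 0"
    by auto
  with sq[of y] show False
    by (simp add: power2_eq_square)
qed

lemma first_norm_one_point:
  fixes w :: "complex \<Rightarrow> complex"
  assumes cont: "continuous_on (ball 0 1) w" and w0: "w 0 = 0"
    and z1: "norm z1 < 1" "norm (w z1) \<ge> 1"
  obtains z0 where "z0 \<noteq> 0" "norm z0 < 1" "norm (w z0) = 1"
    "\<And>z. norm z < norm z0 \<Longrightarrow> norm (w z) < 1"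
proof -
  \<comment> \<open>Cutting down to the closed disc through \<open>z1\<close> makes this set
    compact, so a point of least modulus exists.\<close>
  define K where "K = cball 0 (norm z1) \<inter> (\<lambda>z. norm (w z)) -` {1..}"
  have c: "continuous_on (cball 0 (norm z1)) (\<lambda>z. norm (w z))"
    using z1 by (intro continuous_intros continuous_on_subset[OF cont]) auto
  have "closed K"
    unfolding K_def by (rule continuous_closed_preimage[OF c]) auto
  then have "compact K"
    using compact_Int_closed[of "cball 0 (norm z1)" K] by (simp add: K_def Int_absorb1)
  moreover have "K \<noteq> {}"
    using z1 by (auto simp: K_def)
  ultimately obtain z0 where z0: "z0 \<in> K" and min: "\<And>z. z \<in> K \<Longrightarrow> norm z0 \<le> norm z"
    using continuous_attains_inf[of K norm] continuous_on_norm_id by blast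
  have less: "norm (w z) < 1" if "norm z < norm z0" for z
    using min[of z] that z0 by (force simp: K_def)
  have ne: "z0 \<noteq> 0"
    using z0 w0 by (auto simp: K_def)
  have "norm (w z0) \<le> 1"
  proof (rule continuous_on_closure_norm_le[of "ball 0 (norm z0)" w])
    show "continuous_on (closure (ball 0 (norm z0))) w"
      using z0 z1 ne by (intro continuous_on_subset[OF cont]) (auto simp: K_def)
  qed (use less ne in \<open>auto intro: less_imp_le\<close>)
  then show thesis
    using that[of z0] ne less z0 z1 by (auto simp: K_def)
qed

lemma norm_power2_minus_one_less:
  fixes \<beta> :: real and p :: "complex \<Rightarrow> complex"
  assumes \<beta>: "\<beta> > 0" and hol: "p holomorphic_on ball 0 1" and p0: "p 0 = 1"
    and bound: "\<And>z. norm z < 1 \<Longrightarrow> norm ((p z)^2 + of_real \<beta> * z * deriv p z - 1) < 1"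
    and z: "norm z < 1"
  shows "norm ((p z)^2 - 1) < 1"
proof (rule ccontr)
  define w where "w = (\<lambda>z. (p z)^2 - 1)"
  assume "\<not> norm ((p z)^2 - 1) < 1"
  then have z1: "norm (w z) \<ge> 1"
    by (simp add: w_def)
  have holw: "w holomorphic_on ball 0 1"
    unfolding w_def by (intro holomorphic_intros hol)
  have w0: "w 0 = 0"
    by (simp add: w_def p0)
  obtain z0 where ne: "z0 \<noteq> 0" and z0: "norm z0 < 1" and wz0: "norm (w z0) = 1"
    and less: "\<And>z. norm z < norm z0 \<Longrightarrow> norm (w z) < 1"
    using first_norm_one_point[OF holomorphic_on_imp_continuous_on[OF holw] w0 z z1] by blast
  have sub: "cball 0 (norm z0) \<subseteq> ball (0 :: complex) 1"
    using z0 by auto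
  obtain m :: real where m: "m \<ge> 1" and jack: "z0 * deriv w z0 = of_real m * w z0"
    using Jack_lemma[OF holw open_ball sub w0 ne] less wz0 by auto
  have "(p has_field_derivative deriv p z0) (at z0)"
    using hol z0 by (intro holomorphic_derivI[of p "ball 0 1"]) auto
  then have "deriv w z0 = 2 * p z0 * deriv p z0"
    unfolding w_def by (intro DERIV_imp_deriv) (auto intro!: derivative_eq_intros)
  with jack have eq: "2 * p z0 * (z0 * deriv p z0) = of_real m * w z0"
    by (simp add: mult_ac)
  then have pne: "p z0 \<noteq> 0"
    using m wz0 by auto
  have cont: "continuous_on (cball 0 (norm z0)) p"
    using z0 by (intro continuous_on_subset[OF holomorphic_on_imp_continuous_on[OF hol]]) auto
  have pos: "Re (p z) > 0" if "z \<in> ball 0 (norm z0)" for z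
  proof (rule Re_pos_if_Re_power2_pos[of "ball 0 (norm z0)" p 0 z])
    show "Re ((p z)^2) > 0" if "z \<in> ball 0 (norm z0)" for z
      using less[of z] that abs_Re_le_cmod[of "w z"] by (auto simp: w_def)
  qed (use that ne p0 cont in \<open>auto intro: continuous_on_subset\<close>)
  have "Re (p z0) \<ge> 0"
  proof (rule continuous_ge_on_closure[of "ball 0 (norm z0)" "\<lambda>z. Re (p z)"])
    show "continuous_on (closure (ball 0 (norm z0))) (\<lambda>z. Re (p z))"
      using cont ne by (auto intro!: continuous_intros)
  qed (use pos ne in \<open>auto intro: less_imp_le\<close>)
  \<comment> \<open>Inversion preserves the closed right half-plane, so the weak inequality that
    survives passage to the boundary point suffices.\<close>
  then have "Re (of_real (\<beta> * m / 2) / p z0) \<ge> 0"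
    using \<beta> m by (auto simp: Re_divide intro!: divide_nonneg_nonneg mult_nonneg_nonneg)
  then have "1 \<le> norm (1 + of_real (\<beta> * m / 2) / p z0)"
    using complex_Re_le_cmod[of "1 + of_real (\<beta> * m / 2) / p z0"] by simp
  moreover have "(p z0)^2 + of_real \<beta> * z0 * deriv p z0 - 1 = w z0 * (1 + of_real (\<beta> * m / 2) / p z0)"
  proof -
    have "z0 * deriv p z0 = of_real m * w z0 / (2 * p z0)"
      using eq pne by (simp add: field_simps)
    then have "of_real \<beta> * z0 * deriv p z0 = w z0 * (of_real (\<beta> * m / 2) / p z0)"
      by (simp add: mult.assoc)
    then show ?thesis
      by (simp add: w_def ring_distribs)
  qed
  ultimately show False
    using bound[OF z0] wz0 by (simp add: norm_mult)
qed

theorem lemma3p6: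
  fixes \<beta> :: real and p :: "complex \<Rightarrow> complex"
  assumes "\<beta> > 0"
    and "p analytic_on unit_disc"
    and "p 0 = 1"
    and "(\<lambda>z. (p z)^2 + complex_of_real \<beta> * z * deriv p z) \<prec> (\<lambda>z. 1 + z)"
  shows "p \<prec> (\<lambda>z. csqrt (1 + z))"
proof -
  have hol: "p holomorphic_on ball 0 1"
    using assms(2) by (rule analytic_imp_holomorphic)
  have bound: "norm ((p z)^2 + of_real \<beta> * z * deriv p z - 1) < 1" if "norm z < 1" for z
    using assms(4) that by (auto simp: subordinate_def image_subset_iff)
  have w: "norm ((p z)^2 - 1) < 1" if "norm z < 1" for z
    using norm_power2_minus_one_less[OF assms(1) hol assms(3) bound that] .
  \<comment> \<open>Applied to \<open>p^2\<close> to fix the sign of \<open>Re p\<close>, and to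
    \<open>1 + z\<close> to avoid the branch cut of \<open>csqrt\<close>.\<close>
  have Re_pos: "Re u > 0" if "norm (u - 1) < 1" for u
    using abs_Re_le_cmod[of "u - 1"] that by simp
  have pos: "Re (p z) > 0" if "z \<in> ball 0 1" for z
    using Re_pos_if_Re_power2_pos[of "ball 0 1" p 0 z] hol w that assms(3) Re_pos
    by (simp add: holomorphic_on_imp_continuous_on)
  show ?thesis
    unfolding subordinate_def
  \<comment> \<open>Squaring \<open>p = csqrt (1 + w)\<close> leaves this as the only possible
    witness.\<close>
  proof (intro conjI exI[of _ "\<lambda>z. (p z)^2 - 1"] ballI)
    have "1 + z \<notin> \<real>\<^sub>\<le>\<^sub>0" if "z \<in> ball 0 1" for z :: complex
      using Re_pos[of "1 + z"] that by (auto simp: complex_nonpos_Reals_iff)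
    then show "(\<lambda>z. csqrt (1 + z)) analytic_on ball 0 1"
      by (intro analytic_intros)
    show "p z = csqrt (1 + ((p z)^2 - 1))" if "z \<in> ball 0 1" for z
      using csqrt_square[of "p z"] pos[OF that] by simp
  qed (use assms w in \<open>auto intro!: analytic_intros\<close>)
qed

end
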